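(* Let $b>2.75885$ and $c\in(0,1]$, and let $\mathtt{F}_2(z)=z\,{}_0F_1(\,;b;z)$. If $${}_1F_2\left(b-\tfrac12;\,b,\,2b-1;\,2\sqrt[3]{42}\right)-c\;{}_1F_2\left(b-\tfrac12;\,b,\,2b-1;\,4\right)<1,$$ then $\dfrac{z\mathtt{F}_2'(z)}{\mathtt{F}_2(z)}\prec\sqrt{1+cz}$. In particular, $\mathtt{F}_2(z)=z\,{}_0F_1(\,;b;z)$ is lemniscate starlike for $b>3.11423$.
   Context: $\mathbb{D}=\{z\in\mathbb{C}:|z|<1\}$. The generalized hypergeometric function is ${}_pF_q(a_1,\dots,a_p;b_1,\dots,b_q;z)=\sum_{n\ge0}\frac{(a_1)_n\cdots(a_p)_n}{(b_1)_n\cdots(b_q)_n}\frac{z^n}{n!}$, where $(a)_0=1$ and $(a)_n=a(a+1)\cdots(a+n-1)$; in particular ${}_0F_1(\,;b;z)=\sum_{n\ge0}\frac{z^n}{(b)_n\,n!}$. For analytic $g,h$ on $\mathbb{D}$, $g\prec h$ (subordination) means $g=h\circ w$ for some analytic $w:\mathbb{D}\to\mathbb{D}$ with $w(0)=0$. Let $\mathcal{S}$ be the class of analytic univalent functions $f$ on $\mathbb{D}$ with $f(0)=0$, $f'(0)=1$; $f\in\mathcal{S}$ is lemniscate starlike if $zf'(z)/f(z)\prec\sqrt{1+z}$ (principal branch; the quotient equals $1$ at $z=0$). *)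

theory Defs
  imports "HOL-Complex_Analysis.Complex_Analysis"
begin

text \<open>
  The generalized hypergeometric series, with the upper parameters and the lower parameters given
  as lists. It is meaningful only if no lower parameter is a nonpositive integer and the series
  converges at \<open>z\<close>; otherwise division by zero and \<^const>\<open>suminf\<close> yield junk values.
\<close>
definition hyp_pFq :: "'a::{real_normed_field,banach} list \<Rightarrow> 'a list \<Rightarrow> 'a \<Rightarrow> 'a" where
  "hyp_pFq as bs z =
     (\<Sum>n. (\<Prod>a\<leftarrow>as. pochhammer a n) / (\<Prod>b\<leftarrow>bs. pochhammer b n) * (z ^ n / fact n))"

definition subordinate :: "(complex \<Rightarrow> complex) \<Rightarrow> (complex \<Rightarrow> complex) \<Rightarrow> bool"
    (infix \<open>\<prec>\<^sub>s\<close> 50) where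
  "g \<prec>\<^sub>s h \<longleftrightarrow>
     g holomorphic_on ball 0 1 \<and> h holomorphic_on ball 0 1 \<and>
     (\<exists>w. w holomorphic_on ball 0 1 \<and> w ` ball 0 1 \<subseteq> ball 0 1 \<and> w 0 = 0 \<and>
          (\<forall>z\<in>ball 0 1. g z = h (w z)))"

definition class_S :: "(complex \<Rightarrow> complex) set" where
  "class_S = {f. f holomorphic_on ball 0 1 \<and> inj_on f (ball 0 1) \<and> f 0 = 0 \<and> deriv f 0 = 1}"

text \<open>
  The quotient \<open>z f'(z) / f(z)\<close>. For \<open>f(0) = 0\<close>, \<open>f'(0) = 1\<close> its singularity at the origin is
  removable with value 1, whereas \<open>0 / 0 = 0\<close> in HOL.
\<close>
definition starlike_quot :: "(complex \<Rightarrow> complex) \<Rightarrow> complex \<Rightarrow> complex" where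
  "starlike_quot f z = (if z = 0 then 1 else z * deriv f z / f z)"

definition lemniscate_starlike :: "(complex \<Rightarrow> complex) \<Rightarrow> bool" where
  "lemniscate_starlike f \<longleftrightarrow> f \<in> class_S \<and> starlike_quot f \<prec>\<^sub>s (\<lambda>z. csqrt (1 + z))"

definition F2 :: "real \<Rightarrow> complex \<Rightarrow> complex" where
  "F2 b z = z * hyp_pFq [] [of_real b] z"

end

theory Submission
  imports Defs
begin

text \<open>
  Write \<open>f\<close> for \<open>\<^sub>0F\<^sub>1(; b; \<cdot>)\<close> and \<open>p b z = z f'(z) / f(z)\<close>, so that the quotient in question is \<open>1 + p b z\<close>.
  The contiguous relation reads \<open>p b z = z / (b + p (b + 1) z)\<close>, so the crude coefficient bound
  \<open>\<bar>p (b + 1) z\<bar> \<le> 1/2\<close> improves to \<open>\<bar>p b z\<bar> \<le> 1 / (b - 1/2)\<close>, and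
  \<open>\<bar>(1 + p b z)\<^sup>2 - 1\<bar> \<le> 2 b / (b - 1/2)\<^sup>2\<close>. A few terms of the \<open>\<^sub>1F\<^sub>2\<close> series show that the hypothesis
  forces \<open>c > 2 b / (b - 1/2)\<^sup>2\<close>; for \<open>c = 1\<close> this inequality is clear once \<open>b \<ge> 3\<close>.
  Univalence follows from \<open>\<bar>F' - 1\<bar> < 1\<close>, checked on the coefficients of \<open>F\<close>.
\<close>

section \<open>Taylor coefficients of \<open>hyp_0F1\<close>\<close>

definition bcoef :: "real \<Rightarrow> nat \<Rightarrow> real" where
  "bcoef b n = 1 / (pochhammer b n * fact n)"

abbreviation hyp_0F1 :: "real \<Rightarrow> complex \<Rightarrow> complex" where
  "hyp_0F1 b z \<equiv> hyp_pFq [] [of_real b] z"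

lemma pochhammer_ge_1:
  assumes "(b::real) \<ge> 1"
  shows "pochhammer b n \<ge> 1"
proof (induction n)
  case (Suc n)
  have "1 * 1 \<le> pochhammer b n * (b + real n)"
    using Suc assms by (intro mult_mono) auto
  then show ?case by (simp add: pochhammer_Suc)
qed simp

lemma bcoef_pos: "b > 0 \<Longrightarrow> bcoef b n > 0"
  by (simp add: bcoef_def pochhammer_pos)

lemma bcoef_le: "b \<ge> 1 \<Longrightarrow> bcoef b n \<le> 1 / fact n"
  using pochhammer_ge_1[of b n] by (auto simp: bcoef_def divide_simps)

lemma bcoef_0 [simp]: "bcoef b 0 = 1"
  by (simp add: bcoef_def)

lemma bcoef_Suc: "bcoef b (Suc n) = bcoef b n / ((b + real n) * (real n + 1))"
  by (simp add: bcoef_def pochhammer_Suc field_simps)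

text \<open>Splitting off the first Pochhammer factor instead of the last raises the parameter by
  one. For the series this says that differentiation turns \<open>hyp_0F1 b\<close> into
  \<open>hyp_0F1 (b + 1)\<close> divided by \<open>b\<close>.\<close>

lemma bcoef_shift: "bcoef b (Suc n) = bcoef (b + 1) n / (b * (real n + 1))"
  by (simp add: bcoef_def pochhammer_rec field_simps)

text \<open>This is \<open>hyp_0F1_contiguous\<close> read off in degree \<open>Suc n\<close>. Once
  the common factor \<open>bcoef (b + 1) n\<close> is pulled out, only the partial fraction
  decomposition of \<open>1 / (b * (m + 1))\<close> remains.\<close>

lemma bcoef_contiguous:
  assumes "b > 0"
  shows "bcoef b (Suc n) = bcoef (b + 1) (Suc n) + bcoef (b + 2) n / (b * (b + 1))"
proof -
  have *: "bcoef (b + 2) n = bcoef (b + 1) n * (b + 1) / (b + 1 + real n)"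
  proof -
    have "(b + 1) * pochhammer (b + 2) n = pochhammer (b + 1) n * (b + 1 + real n)"
      using pochhammer_rec[of "b + 1" n] pochhammer_Suc[of "b + 1" n] by (simp add: add_ac)
    moreover have "pochhammer (b + 1) n > 0" "pochhammer (b + 2) n > 0" "b + 1 + real n > 0"
      using assms by (auto intro!: pochhammer_pos)
    ultimately show ?thesis by (simp add: bcoef_def frac_eq_eq)
  qed
  have **: "bcoef (b + 1) (Suc n) = bcoef (b + 1) n / ((b + 1 + real n) * (real n + 1))"
    by (rule bcoef_Suc)
  define m where "m = real n"
  have "m \<ge> 0" by (simp add: m_def)
  then have "1 / (b * (m + 1)) = 1 / ((b + 1 + m) * (m + 1)) + 1 / (b * (b + 1 + m))"
    using assms by (simp add: divide_simps)
  then have "bcoef (b + 1) n * (1 / (b * (m + 1))) =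
      bcoef (b + 1) n * (1 / ((b + 1 + m) * (m + 1)) + 1 / (b * (b + 1 + m)))"
    by (rule arg_cong)
  moreover have "bcoef (b + 1) n * (b + 1) / (b + 1 + m) / (b * (b + 1)) =
      bcoef (b + 1) n / (b * (b + 1 + m))"
    using assms by (simp add: divide_simps)
  ultimately show ?thesis
    unfolding * ** bcoef_shift[of b n] m_def [symmetric]
    by (simp only: distrib_left times_divide_eq_right mult_1_right)
qed

section \<open>Power series, derivative and contiguous relation\<close>

lemma hyp_0F1_altdef: "hyp_0F1 b z = (\<Sum>n. of_real (bcoef b n) * z ^ n)"
  by (simp add: hyp_pFq_def bcoef_def pochhammer_of_real)

lemma summable_0F1:
  assumes "b \<ge> 1"
  shows "summable (\<lambda>n. of_real (bcoef b n) * (z :: complex) ^ n)"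
proof (rule summable_comparison_test')
  show "summable (\<lambda>n. norm z ^ n / fact n)"
    using summable_exp[of "norm z"] by (simp add: field_simps)
  fix n
  have "norm (of_real (bcoef b n) * z ^ n) = bcoef b n * norm z ^ n"
    using bcoef_pos[of b n] assms by (simp add: norm_mult norm_power)
  also have "\<dots> \<le> 1 / fact n * norm z ^ n"
    using bcoef_le[OF assms] by (intro mult_right_mono) auto
  finally show "norm (of_real (bcoef b n) * z ^ n) \<le> norm z ^ n / fact n" by simp
qed

lemma hyp_0F1_0 [simp]: "hyp_0F1 b 0 = 1"
  by (simp add: hyp_0F1_altdef powser_zero)

lemma has_field_derivative_0F1:
  assumes "b \<ge> 1"
  shows "(hyp_0F1 b has_field_derivative hyp_0F1 (b + 1) z / of_real b) (at z)"
proof -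
  have eq: "hyp_0F1 b = (\<lambda>z. \<Sum>n. of_real (bcoef b n) * z ^ n)"
    by (rule ext) (rule hyp_0F1_altdef)
  have "((\<lambda>z. \<Sum>n. of_real (bcoef b n) * z ^ n) has_field_derivative
      (\<Sum>n. diffs (\<lambda>n. of_real (bcoef b n)) n * z ^ n)) (at z)"
    by (rule termdiffs_strong_converges_everywhere) (rule summable_0F1[OF assms])
  moreover have "diffs (\<lambda>n. of_real (bcoef b n)) n * z ^ n =
      (of_real (bcoef (b + 1) n) * z ^ n) / of_real b" for n
  proof -
    have "(real n + 1) * bcoef b (Suc n) = bcoef (b + 1) n / b"
      by (simp add: bcoef_shift)
    then have "complex_of_real ((real n + 1) * bcoef b (Suc n)) = of_real (bcoef (b + 1) n / b)"
      by simp
    then show ?thesis by (simp add: diffs_def add.commute)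
  qed
  ultimately show ?thesis
    using assms unfolding eq hyp_0F1_altdef[of "b + 1"]
    by (simp add: suminf_divide summable_0F1)
qed

text \<open>The contiguous relation for coefficients concerns positive degrees, and the later
  estimates compare the function with its constant term 1; both need that term split off.\<close>

lemma hyp_0F1_split:
  assumes "b \<ge> 1"
  shows "summable (\<lambda>n. of_real (bcoef b (Suc n)) * z ^ n)"
    and "hyp_0F1 b z = 1 + z * (\<Sum>n. of_real (bcoef b (Suc n)) * z ^ n)"
proof -
  show "hyp_0F1 b z = 1 + z * (\<Sum>n. of_real (bcoef b (Suc n)) * z ^ n)"
    using powser_split_head(1)[OF summable_0F1[OF assms], of z]
    by (simp add: hyp_0F1_altdef mult.commute)
  show "summable (\<lambda>n. of_real (bcoef b (Suc n)) * z ^ n)"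
    using powser_split_head(3)[OF summable_0F1[OF assms], of z] by simp
qed

lemma hyp_0F1_contiguous:
  assumes "b \<ge> 1"
  shows "hyp_0F1 b z = hyp_0F1 (b + 1) z + z * hyp_0F1 (b + 2) z / of_real (b * (b + 1))"
proof -
  let ?K = "of_real (b * (b + 1)) :: complex"
  have eq: "of_real (bcoef b (Suc n)) * z ^ n = of_real (bcoef (b + 1) (Suc n)) * z ^ n
      + of_real (bcoef (b + 2) n) * z ^ n / ?K" for n
    using assms by (subst bcoef_contiguous) (auto simp: ring_distribs)
  have "(\<Sum>n. of_real (bcoef b (Suc n)) * z ^ n) =
      (\<Sum>n. of_real (bcoef (b + 1) (Suc n)) * z ^ n) + hyp_0F1 (b + 2) z / ?K"
    unfolding eq hyp_0F1_altdef[of "b + 2"] using assms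
    by (subst suminf_add[symmetric]) (auto intro!: hyp_0F1_split summable_divide summable_0F1
        simp: suminf_divide summable_0F1)
  moreover have "hyp_0F1 (b + 1) z = 1 + z * (\<Sum>n. of_real (bcoef (b + 1) (Suc n)) * z ^ n)"
    using assms by (intro hyp_0F1_split) auto
  ultimately show ?thesis
    using assms by (simp only: hyp_0F1_split(2)[of b] distrib_left add.assoc times_divide_eq_right)
qed

section \<open>Geometric bounds on the coefficients\<close>

text \<open>The weight is \<open>2 * (n + 1) + 1\<close>: twice the factor produced by
  differentiation, plus one for the function itself. At \<open>b = 15/4\<close> the first term is
  exactly 4/5, and consecutive terms have ratio at most 10/57 < 9/50. The geometric series sums to
  40/41, just below 1.\<close>

lemma bcoef_bound_half:
  assumes "b \<ge> 15/4"
  shows "(2 * real n + 3) * bcoef b (Suc n) \<le> 4/5 * (9/50) ^ n"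
proof (induction n)
  case 0
  then show ?case using assms by (simp add: bcoef_Suc divide_simps)
next
  case (Suc n)
  define m where "m = real n"
  have m: "m \<ge> 0" by (simp add: m_def)
  have "50 * (2 * m + 5) \<le> 9 * ((2 * m + 3) * (19/4 * (m + 2)))"
    using m by (simp add: algebra_simps)
  also have "\<dots> \<le> 9 * ((2 * m + 3) * ((b + m + 1) * (m + 2)))"
    using m assms by (intro mult_left_mono mult_right_mono) auto
  finally have "(2 * m + 5) / ((b + m + 1) * (m + 2)) \<le> 9/50 * (2 * m + 3)"
    using m assms by (subst pos_divide_le_eq) (auto simp: mult_ac)
  then have "(2 * m + 5) / ((b + m + 1) * (m + 2)) * bcoef b (Suc n) \<le>
      9/50 * (2 * m + 3) * bcoef b (Suc n)"
    using bcoef_pos[of b "Suc n"] assms by (intro mult_right_mono) auto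
  also have "\<dots> \<le> 9/50 * (4/5 * (9/50) ^ n)"
    using mult_left_mono[OF Suc, of "9/50"] by (simp add: m_def mult_ac)
  finally show ?case
    by (subst bcoef_Suc) (simp add: m_def add_ac)
qed

text \<open>Differentiating \<open>F2 b\<close> multiplies its coefficient of degree
  \<open>n + 2\<close>, namely \<open>bcoef b (Suc n)\<close>, by \<open>n + 2\<close>. At
  \<open>b = 3\<close> the first term is 2/3 and the first ratio is 3/16; the resulting sum 32/39 is
  the contraction constant in \<open>F2_inj_on\<close>.\<close>

lemma bcoef_bound_deriv:
  assumes "b \<ge> 3"
  shows "(real n + 2) * bcoef b (Suc n) \<le> 2/3 * (3/16) ^ n"
proof (induction n)
  case 0
  then show ?case using assms by (simp add: bcoef_Suc divide_simps)
next
  case (Suc n)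
  define m where "m = real n"
  have m: "m \<ge> 0" by (simp add: m_def)
  have X: "0 < (b + m + 1) * (m + 2)" using m assms by (intro mult_pos_pos) auto
  have "16 * (m + 3) \<le> 3 * ((m + 2) * (4 * (m + 2)))"
    using m by (simp add: algebra_simps)
  also have "\<dots> \<le> 3 * ((m + 2) * ((b + m + 1) * (m + 2)))"
    using m assms by (intro mult_left_mono mult_right_mono) auto
  finally have "(m + 3) / ((b + m + 1) * (m + 2)) \<le> 3/16 * (m + 2)"
    unfolding pos_divide_le_eq[OF X] mult.assoc by simp
  then have "(m + 3) / ((b + m + 1) * (m + 2)) * bcoef b (Suc n) \<le>
      3/16 * (m + 2) * bcoef b (Suc n)"
    using bcoef_pos[of b "Suc n"] assms by (intro mult_right_mono) auto
  also have "\<dots> \<le> 3/16 * (2/3 * (3/16) ^ n)"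
    using mult_left_mono[OF Suc, of "3/16"] by (simp add: m_def mult_ac)
  finally show ?case
    by (subst bcoef_Suc) (simp add: m_def add_ac)
qed

section \<open>Bounds for the logarithmic derivative\<close>

text \<open>With G and F the sums of the moduli of the terms of the derivative and of the
  nonconstant part divided by \<open>z\<close>, the coefficient bound gives 2 G + F < 1. Hence G <
  (1 - F) / 2, while 1 - F is a lower bound for the modulus of the function.\<close>

lemma norm_log_deriv_le_half:
  assumes b: "b \<ge> 15/4" and z: "norm z \<le> 1"
  shows "norm (z * hyp_0F1 (b + 1) z / of_real b) \<le> 1/2 * norm (hyp_0F1 b z)"
    and "hyp_0F1 b z \<noteq> 0"
proof -
  let ?f = "\<lambda>n. of_real (bcoef b (Suc n)) * z ^ n"
  let ?g = "\<lambda>n. of_real (bcoef (b + 1) n) * z ^ n / of_real b"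
  have zn: "norm z ^ n \<le> 1" for n using z by (simp add: power_le_one)
  have nf: "norm (?f n) \<le> bcoef b (Suc n)" for n
    using zn[of n] bcoef_pos[of b "Suc n"] b by (simp add: norm_mult norm_power mult_left_le)
  have ng: "norm (?g n) \<le> (real n + 1) * bcoef b (Suc n)" for n
    using zn[of n] bcoef_pos[of "b + 1" n] b
    by (simp add: norm_mult norm_divide norm_power bcoef_shift divide_right_mono mult_left_le)
  have geo: "(\<lambda>n. 4/5 * (9/50::real) ^ n) sums (4/5 * (1 / (1 - 9/50)))"
    by (intro sums_mult geometric_sums) auto
  \<comment> \<open>By \<open>bcoef_shift\<close> both series are governed by the same
    \<open>bcoef b (Suc n)\<close>, so they can be summed term by term with total weight
    \<open>2 * n + 3\<close>.\<close>
  have bd: "2 * norm (?g n) + norm (?f n) \<le> 4/5 * (9/50) ^ n" for n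
  proof -
    have "2 * norm (?g n) + norm (?f n) \<le> (2 * real n + 3) * bcoef b (Suc n)"
      using nf[of n] ng[of n] by (simp add: algebra_simps)
    then show ?thesis using bcoef_bound_half[OF b, of n] by linarith
  qed
  have sf: "summable (\<lambda>n. norm (?f n))"
  proof (rule summable_comparison_test'[OF sums_summable[OF geo]])
    show "norm (norm (?f n)) \<le> 4/5 * (9/50) ^ n" for n
      using bd[of n] norm_ge_zero[of "?f n"] norm_ge_zero[of "?g n"]
      unfolding real_norm_def abs_norm_cancel by linarith
  qed
  have sg: "summable (\<lambda>n. norm (?g n))"
  proof (rule summable_comparison_test'[OF sums_summable[OF geo]])
    show "norm (norm (?g n)) \<le> 4/5 * (9/50) ^ n" for n
      using bd[of n] norm_ge_zero[of "?f n"] norm_ge_zero[of "?g n"]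
      unfolding real_norm_def abs_norm_cancel by linarith
  qed
  have "2 * (\<Sum>n. norm (?g n)) + (\<Sum>n. norm (?f n)) = (\<Sum>n. 2 * norm (?g n) + norm (?f n))"
    using suminf_add[OF summable_mult[OF sg, of 2] sf] suminf_mult[OF sg, of 2] by simp
  also have "\<dots> \<le> (\<Sum>n. 4/5 * (9/50) ^ n)"
    by (intro suminf_le bd summable_add summable_mult sf sg sums_summable[OF geo])
  also have "\<dots> < 1" using sums_unique[OF geo] by simp
  finally have *: "2 * (\<Sum>n. norm (?g n)) + (\<Sum>n. norm (?f n)) < 1" .
  have Gle: "norm (hyp_0F1 (b + 1) z / of_real b) \<le> (\<Sum>n. norm (?g n))"
  proof -
    have "hyp_0F1 (b + 1) z / of_real b = suminf ?g"
      unfolding hyp_0F1_altdef by (rule suminf_divide[OF summable_0F1, symmetric]) (use b in simp)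
    then show ?thesis using summable_norm[OF sg] by metis
  qed
  have "norm (z * (hyp_0F1 (b + 1) z / of_real b)) \<le> 1 * (\<Sum>n. norm (?g n))"
    unfolding norm_mult using z by (intro mult_mono Gle) auto
  then have G: "norm (z * hyp_0F1 (b + 1) z / of_real b) \<le> (\<Sum>n. norm (?g n))" by simp
  have "norm (z * suminf ?f) \<le> 1 * (\<Sum>n. norm (?f n))"
    by (subst norm_mult) (rule mult_mono[OF z summable_norm[OF sf]]; simp)
  moreover have "1 - norm (z * suminf ?f) \<le> norm (hyp_0F1 b z)"
    using norm_triangle_ineq4[of "hyp_0F1 b z" "z * suminf ?f"] b
    by (simp add: hyp_0F1_split(2)[of b])
  ultimately have F: "1 - (\<Sum>n. norm (?f n)) \<le> norm (hyp_0F1 b z)" by linarith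
  show "norm (z * hyp_0F1 (b + 1) z / of_real b) \<le> 1/2 * norm (hyp_0F1 b z)"
    using * F G by linarith
  have "0 \<le> (\<Sum>n. norm (?g n))" by (intro suminf_nonneg sg) simp
  then have "0 < norm (hyp_0F1 b z)" using * F by linarith
  then show "hyp_0F1 b z \<noteq> 0" by simp
qed

text \<open>Multiplied by \<open>b\<close>, the contiguous relation writes
  \<open>of_real b * hyp_0F1 b z\<close> as \<open>of_real b * f + g\<close>, where the crude bound
  at \<open>b + 1\<close> gives |g| <= |f| / 2. So its modulus is at least
  \<open>(b - 1/2) * norm f\<close>, which yields both claims. The threshold 11/4 is 15/4 -
  1.\<close>

lemma norm_log_deriv_le:
  assumes b: "b \<ge> 11/4" and z: "norm z \<le> 1"
  shows "hyp_0F1 b z \<noteq> 0"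
    and "norm (z * hyp_0F1 (b + 1) z / (of_real b * hyp_0F1 b z)) \<le> 1 / (b - 1/2)"
proof -
  define f where "f = hyp_0F1 (b + 1) z"
  define g where "g = z * hyp_0F1 (b + 1 + 1) z / of_real (b + 1)"
  have half: "norm g \<le> 1/2 * norm f" and nz: "f \<noteq> 0"
    unfolding f_def g_def by (rule norm_log_deriv_le_half; use b z in simp)+
  have "of_real b * hyp_0F1 b z =
      of_real b * f + of_real b * (z * hyp_0F1 (b + 2) z / of_real (b * (b + 1)))"
    unfolding f_def by (subst hyp_0F1_contiguous) (use b in \<open>auto simp only: distrib_left\<close>)
  also have "of_real b * (z * hyp_0F1 (b + 2) z / of_real (b * (b + 1))) = g"
    using b by (simp add: g_def add.assoc del: of_real_add)
  finally have eq: "of_real b * hyp_0F1 b z = of_real b * f + g" .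
  have "b * norm f \<le> norm (of_real b * f + g) + norm g"
    using norm_triangle_ineq4[of "of_real b * f + g" g] b by (simp add: norm_mult)
  then have ge: "(b - 1/2) * norm f \<le> norm (of_real b * hyp_0F1 b z)"
    using half unfolding eq by (simp add: algebra_simps)
  have pos: "0 < (b - 1/2) * norm f" using nz b by simp
  then show "hyp_0F1 b z \<noteq> 0" using ge by auto
  have "norm (z * f / (of_real b * hyp_0F1 b z)) = norm z * norm f / norm (of_real b * hyp_0F1 b z)"
    by (simp add: norm_divide norm_mult)
  also have "\<dots> \<le> 1 * norm f / ((b - 1/2) * norm f)"
    using z pos ge by (intro frac_le mult_right_mono) auto
  also have "\<dots> = 1 / (b - 1/2)" using nz by simp
  finally show "norm (z * hyp_0F1 (b + 1) z / (of_real b * hyp_0F1 b z)) \<le> 1 / (b - 1/2)"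
    by (simp add: f_def)
qed

section \<open>Subordination of the quotient to the square root\<close>

lemma F2_has_field_derivative:
  assumes "b \<ge> 1"
  shows "(F2 b has_field_derivative hyp_0F1 b z + z * hyp_0F1 (b + 1) z / of_real b) (at z)"
  unfolding F2_def[abs_def] using DERIV_mult[OF DERIV_ident has_field_derivative_0F1[OF assms]]
  by (simp add: add.commute mult.commute)

text \<open>Solving \<open>q = csqrt (1 + c * w)\<close> for \<open>w\<close> gives the Schwarz
  function (q^2 - 1) / c. The positive real part of \<open>q\<close> ensures that the principal root
  of q^2 is \<open>q\<close> and not its negative; \<open>c \<le> 1\<close> keeps
  \<open>1 + c * z\<close> off the branch cut.\<close>

lemma subordinate_csqrt_if_norm_less:
  assumes hol: "q holomorphic_on ball 0 1" and q0: "q 0 = 1" and c: "c \<in> {0<..1}"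
    and Re: "\<And>z. z \<in> ball 0 1 \<Longrightarrow> Re (q z) > 0"
    and bd: "\<And>z. z \<in> ball 0 1 \<Longrightarrow> norm ((q z)\<^sup>2 - 1) < c"
  shows "q \<prec>\<^sub>s (\<lambda>z. csqrt (1 + of_real c * z))"
  unfolding subordinate_def
proof (intro conjI exI[of _ "\<lambda>z. ((q z)\<^sup>2 - 1) / of_real c"] ballI)
  show "(\<lambda>z. csqrt (1 + of_real c * z)) holomorphic_on ball 0 1"
  proof (rule holomorphic_on_csqrt')
    fix z :: complex assume "z \<in> ball 0 1"
    have "\<bar>c * Re z\<bar> \<le> 1 * norm z"
      unfolding abs_mult using c abs_Re_le_cmod[of z] by (intro mult_mono) auto
    then have "Re (1 + of_real c * z) > 0" using \<open>z \<in> ball 0 1\<close> by simp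
    then show "1 + of_real c * z \<notin> \<real>\<^sub>\<le>\<^sub>0" by (auto simp: complex_nonpos_Reals_iff)
  qed (auto intro!: holomorphic_intros)
  show "(\<lambda>z. ((q z)\<^sup>2 - 1) / of_real c) ` ball 0 1 \<subseteq> ball 0 1"
  proof
    fix w assume "w \<in> (\<lambda>z. ((q z)\<^sup>2 - 1) / of_real c) ` ball 0 1"
    then obtain z where "z \<in> ball 0 1" "w = ((q z)\<^sup>2 - 1) / of_real c" by auto
    then show "w \<in> ball 0 1" using bd[of z] c by (simp add: norm_divide)
  qed
  show "q z = csqrt (1 + of_real c * (((q z)\<^sup>2 - 1) / of_real c))" if "z \<in> ball 0 1" for z
    using Re[OF that] c by (simp add: csqrt_square)
qed (use hol q0 c in \<open>auto intro!: holomorphic_intros\<close>)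

lemma starlike_quot_F2_subordinate:
  assumes b: "b \<ge> 11/4" and c: "c \<in> {0<..1}" and bc: "2 * b / (b - 1/2)\<^sup>2 < c"
  shows "starlike_quot (F2 b) \<prec>\<^sub>s (\<lambda>z. csqrt (1 + of_real c * z))"
proof (rule subordinate_csqrt_if_norm_less[OF _ _ c])
  let ?p = "\<lambda>z. z * hyp_0F1 (b + 1) z / (of_real b * hyp_0F1 b z)"
  \<comment> \<open>The right side is also 1 at the origin, so the formula agrees with the
    convention in \<open>starlike_quot\<close> there and gives holomorphy on the whole disc.\<close>
  have q: "starlike_quot (F2 b) z = 1 + ?p z" if "z \<in> ball 0 1" for z
  proof (cases "z = 0")
    case False
    have "deriv (F2 b) z = hyp_0F1 b z + z * hyp_0F1 (b + 1) z / of_real b"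
      using b by (intro DERIV_imp_deriv F2_has_field_derivative) auto
    then show ?thesis
      using False norm_log_deriv_le(1)[OF b, of z] that b
      by (simp add: starlike_quot_def F2_def field_simps)
  qed (simp add: starlike_quot_def)
  have p: "norm (?p z) \<le> 1 / (b - 1/2)" if "z \<in> ball 0 1" for z
    using norm_log_deriv_le(2)[OF b, of z] that by simp
  have hol: "hyp_0F1 \<beta> holomorphic_on A" if "\<beta> \<ge> 1" for \<beta> A
    using has_field_derivative_0F1[OF that]
    by (auto simp: holomorphic_on_def field_differentiable_def intro: DERIV_subset)
  have "(\<lambda>z. 1 + ?p z) holomorphic_on ball 0 1"
    using b norm_log_deriv_le(1)[OF b] by (intro holomorphic_intros hol) auto
  then show "starlike_quot (F2 b) holomorphic_on ball 0 1"
    by (rule holomorphic_transform) (simp add: q)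
  show "starlike_quot (F2 b) 0 = 1" by (simp add: starlike_quot_def)
  show "Re (starlike_quot (F2 b) z) > 0" if z: "z \<in> ball 0 1" for z
  proof -
    have "1 / (b - 1/2) < 1" using b by simp
    then have "\<bar>Re (?p z)\<bar> < 1" using p[OF z] abs_Re_le_cmod[of "?p z"] by linarith
    then show ?thesis unfolding q[OF z] by simp
  qed
  show "norm ((starlike_quot (F2 b) z)\<^sup>2 - 1) < c" if z: "z \<in> ball 0 1" for z
  proof -
    have "norm ((starlike_quot (F2 b) z)\<^sup>2 - 1) = norm (?p z * (2 + ?p z))"
      unfolding q[OF z] by (simp add: power2_eq_square algebra_simps)
    also have "\<dots> \<le> norm (?p z) * (2 + norm (?p z))"
      unfolding norm_mult by (intro mult_left_mono order.trans[OF norm_triangle_ineq]) auto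
    \<comment> \<open>The map r (2 + r) is increasing for r >= 0; at r = 1 / (b - 1/2) it equals the
      quantity assumed to be below \<open>c\<close>.\<close>
    also have "\<dots> \<le> 1 / (b - 1/2) * (2 + 1 / (b - 1/2))"
      using p[OF z] b by (intro mult_mono) auto
    also have "\<dots> = 2 * b / (b - 1/2)\<^sup>2"
      using b by (simp add: field_simps power2_eq_square)
    finally show ?thesis using bc by simp
  qed
qed

section \<open>Univalence and normalization\<close>

text \<open>The map is a perturbation of the identity: on the disc \<open>F2 b x - x\<close> is
  Lipschitz with constant 32/39, since the difference of m-th powers is at most m times that of the
  points. Equal values at distinct points would force it to move them by their full
  distance.\<close>

lemma F2_inj_on:
  assumes b: "b \<ge> 3"
  shows "inj_on (F2 b) (ball 0 1)"
proof (rule inj_onI, rule ccontr)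
  fix z w :: complex assume z: "z \<in> ball 0 1" and w: "w \<in> ball 0 1"
    and eq: "F2 b z = F2 b w" and ne: "z \<noteq> w"
  let ?h = "\<lambda>n. of_real (bcoef b (Suc n)) * (z ^ Suc (Suc n) - w ^ Suc (Suc n))"
  have F2: "F2 b x = x + x\<^sup>2 * (\<Sum>n. of_real (bcoef b (Suc n)) * x ^ n)" for x
    using b by (simp add: F2_def hyp_0F1_split(2) algebra_simps power2_eq_square)
  have sm: "(\<lambda>n. of_real (bcoef b (Suc n)) * x ^ Suc (Suc n)) sums (F2 b x - x)" for x
    using sums_mult[OF summable_sums[OF hyp_0F1_split(1)[of b x]], of "x\<^sup>2"] b
    by (simp add: F2 power2_eq_square mult_ac)
  have h: "?h sums (w - z)"
    using sums_diff[OF sm[of z] sm[of w]] eq by (simp add: right_diff_distrib)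
  have nh: "norm (?h n) \<le> 2/3 * (3/16) ^ n * norm (z - w)" for n
  proof -
    have "norm (?h n) \<le> bcoef b (Suc n) * (real (Suc (Suc n)) * norm (z - w))"
      unfolding norm_mult using z w bcoef_pos[of b "Suc n"] b
      by (intro mult_mono norm_power_diff) auto
    also have "\<dots> = (real n + 2) * bcoef b (Suc n) * norm (z - w)" by simp
    also have "\<dots> \<le> 2/3 * (3/16) ^ n * norm (z - w)"
      by (intro mult_right_mono bcoef_bound_deriv b) auto
    finally show ?thesis .
  qed
  have geo: "(\<lambda>n. 2/3 * (3/16::real) ^ n * norm (z - w)) sums
      (2/3 * (1 / (1 - 3/16)) * norm (z - w))"
    by (intro sums_mult sums_mult2 geometric_sums) auto
  have "norm (w - z) \<le> 2/3 * (1 / (1 - 3/16)) * norm (z - w)"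
    using norm_suminf_le[OF nh sums_summable[OF geo]] sums_unique[OF h] sums_unique[OF geo] by simp
  also have "\<dots> < norm (z - w)" using ne by simp
  finally show False by (simp add: norm_minus_commute)
qed

lemma F2_in_class_S:
  assumes b: "b \<ge> 3"
  shows "F2 b \<in> class_S"
proof -
  have d: "(F2 b has_field_derivative hyp_0F1 b z + z * hyp_0F1 (b + 1) z / of_real b) (at z)" for z
    using b by (intro F2_has_field_derivative) auto
  have "F2 b holomorphic_on ball 0 1"
    using d by (auto simp: holomorphic_on_def field_differentiable_def intro: DERIV_subset)
  moreover have "deriv (F2 b) 0 = 1" using DERIV_imp_deriv[OF d[of 0]] by simp
  ultimately show ?thesis
    using F2_inj_on[OF b] by (simp add: class_S_def F2_def)
qed

section \<open>Estimates for the two values of the 1F2 series\<close>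

definition hcoef :: "real \<Rightarrow> nat \<Rightarrow> real" where
  "hcoef b n = pochhammer (b - 1/2) n / (pochhammer b n * pochhammer (2 * b - 1) n * fact n)"

lemma hyp_1F2_altdef: "hyp_pFq [b - 1/2] [b, 2 * b - 1] x = (\<Sum>n. hcoef b n * x ^ n)" for x :: real
  by (simp add: hyp_pFq_def hcoef_def)

lemma hcoef_0 [simp]: "hcoef b 0 = 1"
  by (simp add: hcoef_def)

lemma hcoef_Suc:
  "hcoef b (Suc n) =
     hcoef b n * ((b - 1/2 + real n) / ((b + real n) * (2 * b - 1 + real n) * (real n + 1)))"
  by (simp add: hcoef_def pochhammer_Suc field_simps)

lemma hcoef_pos: "b > 1/2 \<Longrightarrow> hcoef b n > 0"
  by (simp add: hcoef_def pochhammer_pos)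

text \<open>The factor \<open>(b - 1/2 + n) / (b + n)\<close> is below 1 and is dropped.\<close>

lemma hcoef_Suc_le:
  assumes "b > 1/2"
  shows "hcoef b (Suc n) \<le> hcoef b n / ((2 * b - 1 + real n) * (real n + 1))"
proof -
  have "(b - 1/2 + real n) / ((b + real n) * (2 * b - 1 + real n) * (real n + 1)) \<le>
      (b + real n) / ((b + real n) * (2 * b - 1 + real n) * (real n + 1))"
    using assms by (intro divide_right_mono) auto
  also have "\<dots> = 1 / ((2 * b - 1 + real n) * (real n + 1))" using assms by simp
  finally have "hcoef b n * ((b - 1/2 + real n) / ((b + real n) * (2 * b - 1 + real n) * (real n + 1)))
      \<le> hcoef b n * (1 / ((2 * b - 1 + real n) * (real n + 1)))"
    using hcoef_pos[OF assms, of n] by (intro mult_left_mono) auto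
  then show ?thesis by (simp add: hcoef_Suc)
qed

lemma hcoef_le:
  assumes "b \<ge> 1"
  shows "hcoef b n \<le> 1 / fact n"
proof (induction n)
  case (Suc n)
  have "hcoef b (Suc n) \<le> hcoef b n / ((2 * b - 1 + real n) * (real n + 1))"
    using assms by (intro hcoef_Suc_le) auto
  also have "\<dots> \<le> (1 / fact n) / (1 * (real n + 1))"
    using Suc assms hcoef_pos[of b n] by (intro frac_le mult_right_mono) auto
  finally show ?case by (simp add: add_ac mult_ac)
qed simp

lemma summable_1F2:
  assumes "b \<ge> 1" and "x \<ge> 0"
  shows "summable (\<lambda>n. hcoef b n * x ^ n)"
proof (rule summable_comparison_test')
  show "summable (\<lambda>n. x ^ n / fact n)"
    using summable_exp[of x] by (simp add: field_simps)
  fix n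
  have "hcoef b n * x ^ n \<le> 1 / fact n * x ^ n"
    using assms hcoef_le by (intro mult_right_mono) auto
  then show "norm (hcoef b n * x ^ n) \<le> x ^ n / fact n"
    using assms hcoef_pos[of b n] by simp
qed

text \<open>Since \<open>2 * b - 1\<close> is twice \<open>b - 1/2\<close>, numerator and
  denominator factors cancel, so all three coefficients fit over the denominator
  \<open>96 * b\<^sup>2 * (b + 1) * (b + 2)\<close>.\<close>

lemma hcoef_1_2_3:
  assumes "b \<ge> 1"
  shows "hcoef b 1 = 1 / (2 * b)" "hcoef b 2 = (2 * b + 1) / (16 * b\<^sup>2 * (b + 1))"
    "hcoef b 3 = (2 * b + 3) / (96 * b\<^sup>2 * (b + 1) * (b + 2))"
proof -
  have "hcoef b 1 = (b - 1/2) / (b * (2 * b - 1))"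
    using hcoef_Suc[of b 0] by simp
  also have "\<dots> = 1 / (2 * b)"
    using assms by (subst frac_eq_eq) (auto simp: algebra_simps)
  finally show 1: "hcoef b 1 = 1 / (2 * b)" .
  show 2: "hcoef b 2 = (2 * b + 1) / (16 * b\<^sup>2 * (b + 1))"
    using assms hcoef_Suc[of b 1] 1
    by (simp add: numeral_2_eq_2 [symmetric]) (simp add: field_simps power2_eq_square)
  have "hcoef b 3 = (2 * b + 1) / (16 * b\<^sup>2 * (b + 1)) * ((b - 1/2 + 2) / ((b + 2) * (2 * b - 1 + 2) * 3))"
    using hcoef_Suc[of b 2] 2 by (simp add: eval_nat_numeral add_ac)
  also have "(b - 1/2 + 2) / ((b + 2) * (2 * b - 1 + 2) * 3) = (2 * b + 3) / (2 * b + 1) / (6 * (b + 2))"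
    using assms by (simp add: divide_simps) (simp add: algebra_simps)
  also have "(2 * b + 1) / (16 * b\<^sup>2 * (b + 1)) * \<dots> = (2 * b + 3) / (96 * b\<^sup>2 * (b + 1) * (b + 2))"
  proof -
    have "x / y * (z / x / (6 * w)) = z / (6 * y * w)" if "x \<noteq> 0" for x y z w :: real
      using that by simp
    from this[of "2 * b + 1"] show ?thesis using assms by (simp add: mult.assoc)
  qed
  finally show "hcoef b 3 = (2 * b + 3) / (96 * b\<^sup>2 * (b + 1) * (b + 2))" .
qed

lemma hyp_1F2_ge:
  assumes "b \<ge> 1" and "x \<ge> 0"
  shows "1 + hcoef b 1 * x + hcoef b 2 * x\<^sup>2 + hcoef b 3 * x ^ 3 \<le> hyp_pFq [b - 1/2] [b, 2 * b - 1] x"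
proof -
  have "(\<Sum>n<4. hcoef b n * x ^ n) \<le> (\<Sum>n. hcoef b n * x ^ n)"
    using assms hcoef_pos[of b] by (intro sum_le_suminf summable_1F2) (auto simp: less_imp_le)
  then show ?thesis by (simp add: hyp_1F2_altdef eval_nat_numeral)
qed

text \<open>From degree 3 on, \<open>2 * b - 1 + n\<close> is at least 15/2 and \<open>n + 1\<close>
  at least 4, so terms at 4 shrink by the ratio 4 / 30 = 2/15. The tail is at most 15/13 times its
  first term.\<close>

lemma hyp_1F2_4_le:
  assumes b: "b \<ge> 11/4"
  shows "hyp_pFq [b - 1/2] [b, 2 * b - 1] 4 \<le>
    1 + hcoef b 1 * 4 + hcoef b 2 * 16 + hcoef b 3 * 64 * (15/13)"
proof -
  have tail: "hcoef b (n + 3) * 4 ^ (n + 3) \<le> hcoef b 3 * 64 * (2/15) ^ n" for n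
  proof (induction n)
    case (Suc n)
    have "hcoef b (Suc n + 3) \<le> hcoef b (n + 3) / ((2 * b - 1 + real (n + 3)) * (real (n + 3) + 1))"
      using hcoef_Suc_le[of b "n + 3"] b by simp
    also have "\<dots> \<le> hcoef b (n + 3) / (15/2 * 4)"
      using b hcoef_pos[of b "n + 3"] by (intro divide_left_mono mult_mono) auto
    finally have "hcoef b (Suc n + 3) * 4 ^ (Suc n + 3) \<le> hcoef b (n + 3) / (15/2 * 4) * 4 ^ (Suc n + 3)"
      by (rule mult_right_mono) simp
    also have "\<dots> = hcoef b (n + 3) * 4 ^ (n + 3) * (2/15)" by (simp add: power_add)
    also have "\<dots> \<le> hcoef b 3 * 64 * (2/15) ^ n * (2/15)"
      using Suc by (intro mult_right_mono) auto
    finally show ?case by simp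
  qed simp
  have geo: "(\<lambda>n. hcoef b 3 * 64 * (2/15) ^ n) sums (hcoef b 3 * 64 * (1 / (1 - 2/15)))"
    by (intro sums_mult geometric_sums) auto
  have sm: "summable (\<lambda>n. hcoef b n * 4 ^ n)" using b by (intro summable_1F2) auto
  have "(\<Sum>n. hcoef b (n + 3) * 4 ^ (n + 3)) \<le> (\<Sum>n. hcoef b 3 * 64 * (2/15) ^ n)"
    by (intro suminf_le tail summable_ignore_initial_segment[OF sm] sums_summable[OF geo])
  moreover have "(\<Sum>n. hcoef b n * 4 ^ n) =
      (\<Sum>n. hcoef b (n + 3) * 4 ^ (n + 3)) + (\<Sum>n<3. hcoef b n * 4 ^ n)"
    by (rule suminf_split_initial_segment[OF sm])
  ultimately show ?thesis
    using sums_unique[OF geo] by (simp add: hyp_1F2_altdef eval_nat_numeral)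
qed

text \<open>
  The threshold \<open>551/200\<close> lies just below \<open>2.75885\<close> and is such that the final polynomial inequality
  has only positive coefficients when expanded around it; \<open>(2 * root 3 42) ^ 3 = 336\<close> is exact.
\<close>
lemma hyp_1F2_bound:
  assumes b: "b \<ge> 551/200"
  shows "2 * b / (b - 1/2)\<^sup>2 * hyp_pFq [b - 1/2] [b, 2 * b - 1] 4 + 1 \<le>
    hyp_pFq [b - 1/2] [b, 2 * b - 1] (2 * root 3 42)"
proof -
  define y :: real where "y = 2 * root 3 42"
  have y3: "y ^ 3 = 336" by (simp add: y_def power_mult_distrib)
  have y0: "y \<ge> 0" by (simp add: y_def)
  \<comment> \<open>The cube root of 336 is about 6.952. A rational lower bound suffices for the
    linear and quadratic terms; the cubic term uses 336 itself.\<close>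
  have y: "y \<ge> 695/100"
  proof (rule ccontr)
    assume "\<not> y \<ge> 695/100"
    then have "y ^ 3 \<le> (695/100) ^ 3" using y0 by (intro power_mono) auto
    moreover have "(695/100) ^ 3 < (336 :: real)" by (simp add: power3_eq_cube)
    ultimately show False using y3 by linarith
  qed
  have y2: "y\<^sup>2 \<ge> (695/100)\<^sup>2" using y by (intro power_mono) auto
  define s where "s = b - 551/200"
  have s: "s \<ge> 0" and bs: "b = s + 551/200" using b by (auto simp: s_def)
  \<comment> \<open>Over the common denominator \<open>D\<close>, \<open>hi\<close> bounds the value
    at 4 from above and \<open>lo\<close> bounds the value at \<open>y\<close> minus 1 from below;
    hence the summand \<open>D\<close> occurs in \<open>hi\<close> only.\<close>
  define D where "D = 96 * b\<^sup>2 * (b + 1) * (b + 2)"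
  define lo where "lo = 48 * b * (b + 1) * (b + 2) * (695/100) + 6 * (2 * b + 1) * (b + 2) * (695/100)\<^sup>2
    + (2 * b + 3) * 336"
  define hi where "hi = D + 48 * b * (b + 1) * (b + 2) * 4 + 6 * (2 * b + 1) * (b + 2) * 16
    + (2 * b + 3) * 64 * (15/13)"
  have D: "D > 0" using b by (simp add: D_def)
  have h: "hcoef b 1 = 48 * b * (b + 1) * (b + 2) / D" "hcoef b 2 = 6 * (2 * b + 1) * (b + 2) / D"
    "hcoef b 3 = (2 * b + 3) / D"
    using b hcoef_1_2_3[of b] by (simp_all add: D_def divide_simps power2_eq_square)
  have "hyp_pFq [b - 1/2] [b, 2 * b - 1] 4 \<le> hi / D"
    using hyp_1F2_4_le[of b] b D unfolding h hi_def by (simp add: add_divide_distrib)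
  then have "2 * b / (b - 1/2)\<^sup>2 * hyp_pFq [b - 1/2] [b, 2 * b - 1] 4 \<le> 2 * b / (b - 1/2)\<^sup>2 * (hi / D)"
    using b by (intro mult_left_mono) auto
  also have "\<dots> \<le> lo / D"
  proof -
    have "lo * (b - 1/2)\<^sup>2 - 2 * b * hi = 447203695061997/10400000000000
        + 172411524826509/5200000000 * s + 900795837789/26000000 * s ^ 2
        + 13279587/1000 * s ^ 3 + 223737/100 * s ^ 4 + 708/5 * s ^ 5"
      unfolding lo_def hi_def D_def bs by algebra
    also have "\<dots> \<ge> 0" using s by simp
    finally have "0 \<le> lo * (b - 1/2)\<^sup>2 - 2 * b * hi" .
    then show ?thesis using D b by (simp add: divide_simps mult_ac)
  qed
  also have "\<dots> \<le> hcoef b 1 * y + hcoef b 2 * y\<^sup>2 + hcoef b 3 * y ^ 3"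
  proof -
    have "lo / D = hcoef b 1 * (695/100) + hcoef b 2 * (695/100)\<^sup>2 + hcoef b 3 * 336"
      unfolding h lo_def by (simp add: add_divide_distrib)
    also have "\<dots> \<le> hcoef b 1 * y + hcoef b 2 * y\<^sup>2 + hcoef b 3 * y ^ 3"
      unfolding y3 using y y2 b hcoef_pos[of b] by (intro add_mono mult_left_mono) (auto simp: less_imp_le)
    finally show ?thesis .
  qed
  also have "\<dots> \<le> hyp_pFq [b - 1/2] [b, 2 * b - 1] y - 1"
    using hyp_1F2_ge[of b y] b y0 by simp
  finally show ?thesis by (simp add: y_def)
qed

theorem theorem4p1:
  "(\<forall>b c :: real. b > 2.75885 \<longrightarrow> c \<in> {0<..1} \<longrightarrow>
      hyp_pFq [b - 1/2] [b, 2 * b - 1] (2 * root 3 42)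
        - c * hyp_pFq [b - 1/2] [b, 2 * b - 1] 4 < 1 \<longrightarrow>
      starlike_quot (F2 b) \<prec>\<^sub>s (\<lambda>z. csqrt (1 + of_real c * z)))
   \<and> (\<forall>b :: real. b > 3.11423 \<longrightarrow> lemniscate_starlike (F2 b))"
proof (intro conjI allI impI)
  fix b c :: real
  let ?H = "hyp_pFq [b - 1/2] [b, 2 * b - 1]"
  assume b: "b > 2.75885" and c: "c \<in> {0<..1}" and H: "?H (2 * root 3 42) - c * ?H 4 < 1"
  have "0 \<le> hcoef b 1" "0 \<le> hcoef b 2" "0 \<le> hcoef b 3"
    using b by (auto intro!: less_imp_le[OF hcoef_pos])
  then have "?H 4 > 0" using hyp_1F2_ge[of b 4] b by simp
  \<comment> \<open>Both sides are compared with \<open>?H (2 * root 3 42) - 1\<close>: the left is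
    at most that by \<open>hyp_1F2_bound\<close>, and the right exceeds it by the
    hypothesis.\<close>
  moreover have "2 * b / (b - 1/2)\<^sup>2 * ?H 4 < c * ?H 4"
    using hyp_1F2_bound[of b] b H by simp
  ultimately have "2 * b / (b - 1/2)\<^sup>2 < c" by (simp only: mult_less_cancel_right_pos)
  then show "starlike_quot (F2 b) \<prec>\<^sub>s (\<lambda>z. csqrt (1 + of_real c * z))"
    using b c by (intro starlike_quot_F2_subordinate) auto
next
  fix b :: real
  assume b: "b > 3.11423"
  \<comment> \<open>The difference \<open>(b - 1/2)\<^sup>2 - 2 * b\<close> equals
    \<open>(b - 3) * b + 1/4\<close>.\<close>
  have "0 \<le> (b - 3) * b" using b by (intro mult_nonneg_nonneg) auto
  then have "2 * b < (b - 1/2)\<^sup>2" by (simp add: power2_eq_square algebra_simps)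
  then have "2 * b / (b - 1/2)\<^sup>2 < 1" using b by simp
  then have "starlike_quot (F2 b) \<prec>\<^sub>s (\<lambda>z. csqrt (1 + of_real 1 * z))"
    using b by (intro starlike_quot_F2_subordinate) auto
  then show "lemniscate_starlike (F2 b)"
    using F2_in_class_S[of b] b by (simp add: lemniscate_starlike_def)
qed

end
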